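(* Let $G$ be a Lie group with gauge frame $\{\mathcal{A}_i^U\}_i$, let $\mathcal{G}$ be a (Riemannian) metric tensor field on $G$ that is constant with respect to the gauge frame, and let $\nu\in\mathbb{R}$. Let $d_{ij}^k$ be the structure functions defined by $d_{ij}^k\mathcal{A}_k^U = [\mathcal{A}_i^U,\mathcal{A}_j^U]$, let $g^{ij}$ be the components of the dual metric $\mathcal{G}^{-1}$ with respect to the gauge frame, and let $\Gamma_{ij}^k$ be the Christoffel symbols of the Levi-Civita connection of $\mathcal{G}$ with respect to the gauge frame. Then, with respect to the gauge frame (summing over repeated indices), the data-driven Lie-Cartan Laplacian $\Delta_{\mathcal{G},\nu}^U$ is given by $$\Delta_{\mathcal{G},\nu}^U = g^{ij}\mathcal{A}_i^U\mathcal{A}_j^U + \nu\, d_{ki}^k\, g^{ij}\mathcal{A}_j^U,$$ while the Laplace-Beltrami operator $\Delta_{\mathcal{G}}$ is given by $$\Delta_{\mathcal{G}} = g^{ij}\mathcal{A}_i^U\mathcal{A}_j^U + \Gamma_{ki}^k\, g^{ij}\mathcal{A}_j^U = g^{ij}\mathcal{A}_i^U\mathcal{A}_j^U + d_{ki}^k\, g^{ij}\mathcal{A}_j^U .$$ The difference is $$\Delta_{\mathcal{G}} - \Delta_{\mathcal{G},\nu}^U = (1-\nu)\, d_{ki}^k\, g^{ij}\mathcal{A}_j^U ,$$ so the two operators $\Delta_{\mathcal{G}}$ and $\Delta_{\mathcal{G},\nu}^U$ coincide if and only if $\nu = 1$.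
   Context: The Einstein summation convention is used throughout. A gauge frame $\{\mathcal{A}_i^U\}_i$ on a Lie group $G$ is a smooth frame of vector fields on $G$ adapted to some data, a function $U$ on $G$; it is in general not left-invariant. A vector field or metric tensor field is constant with respect to the gauge frame if its components in that frame are constant functions on $G$; so here $g_{ij} = \mathcal{G}(\mathcal{A}_i^U,\mathcal{A}_j^U)$ are constants and $(g^{ij})$ is the inverse matrix of $(g_{ij})$. The gradient of a smooth function $f$ is $\nabla_{\mathcal{G}} f = g^{ij}(\mathcal{A}_i^U f)\mathcal{A}_j^U$. The Christoffel symbols with respect to the gauge frame are given by $\nabla^{\mathrm{LC}}_{\mathcal{A}_i^U}\mathcal{A}_j^U = \Gamma_{ij}^k\mathcal{A}_k^U$, where $\nabla^{\mathrm{LC}}$ is the Levi-Civita connection of $\mathcal{G}$. The structure functions $d_{ij}^k$ take the place that the structure constants have for a left-invariant frame; they do not have a closed form and have non-vanishing trace in general (this is a remark accompanying the statement). Generalised Laplacian: for a Riemannian manifold $(M,\mathcal{G})$ and an affine connection $\nabla$ on $M$, define the divergence of a smooth vector field $X$ by $\mathrm{div}_\nabla(X) = \mathrm{trace}(\nabla_{\cdot}X)$, i.e. the pointwise trace of the endomorphism $Z \mapsto \nabla_Z X$, and define $\Delta_{\mathcal{G},\nabla} f = \mathrm{div}_\nabla(\nabla_{\mathcal{G}} f)$. The Laplace-Beltrami operator is $\Delta_{\mathcal{G}} = \mathrm{div}_{\mathcal{G}} \circ \nabla_{\mathcal{G}}$, with $\mathrm{div}_{\mathcal{G}}$ the Riemannian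 divergence, which equals $\mathrm{div}_{\nabla^{\mathrm{LC}}}$. Gauge frame Lie-Cartan connection: for $\nu\in\mathbb{R}$, the $\nu$ gauge frame Lie-Cartan connection $\nabla^{[\nu],U}$ on $G$ is the affine connection such that $\nabla^{[\nu],U}_X Y = \nu[X,Y]$ for all smooth vector fields $X,Y$ on $G$ that are constant with respect to $\{\mathcal{A}_i^U\}_i$. The data-driven Lie-Cartan Laplacian is $\Delta_{\mathcal{G},\nu}^U = \Delta_{\mathcal{G},\nabla^{[\nu],U}}$.
   Formalization: "Coincide if and only if ν = 1" is proved when the trace d_{ki}^k is not identically zero (ν = 1 implies coincidence always); without this it is false, e.g. on R^n with the coordinate frame, where d = 0 and the operators agree for every ν. *)

theory Defs
  imports "HOL-Analysis.Analysis" "HOL-Library.Function_Algebras"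
begin

instantiation "fun" :: (type, real_vector) real_vector
begin

definition scaleR_fun :: "real \<Rightarrow> ('a \<Rightarrow> 'b) \<Rightarrow> 'a \<Rightarrow> 'b"
  where "scaleR_fun c f = (\<lambda>x. c *\<^sub>R f x)"

instance
  by standard (auto simp: scaleR_fun_def fun_eq_iff scaleR_add_right scaleR_add_left)

end

lemma scaleR_fun_apply: "(c *\<^sub>R f) x = c *\<^sub>R f x"
  by (simp add: scaleR_fun_def)


section \<open>Smooth manifolds and Lie groups\<close>

text \<open>For open \<open>S\<close> in a finite-dimensional space, all directional derivatives being
  \<open>C\<^sup>k\<close> is the same as the total derivative being \<open>C\<^sup>k\<close>. All uses below are for open \<open>S\<close>.\<close>

primrec Ck_on :: "nat \<Rightarrow> 'a::real_normed_vector set \<Rightarrow> ('a \<Rightarrow> 'b::real_normed_vector) \<Rightarrow> bool"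
  where
    "Ck_on 0 S f \<longleftrightarrow> continuous_on S f"
  | "Ck_on (Suc k) S f \<longleftrightarrow>
       f differentiable_on S \<and> (\<forall>v. Ck_on k S (\<lambda>x. frechet_derivative f (at x) v))"

definition smooth_on :: "'a::real_normed_vector set \<Rightarrow> ('a \<Rightarrow> 'b::real_normed_vector) \<Rightarrow> bool"
  where "smooth_on S f \<longleftrightarrow> (\<forall>k. Ck_on k S f)"

type_synonym ('m, 'e) chart = "'m set \<times> ('m \<Rightarrow> 'e)"

text \<open>The manifold is the whole type \<open>'m\<close>; the Hausdorff and second countability axioms are
  imposed as sort constraints on \<open>'m\<close> where needed. An atlas need not be maximal.\<close>

definition smooth_atlas ::
    "('m::{t2_space, second_countable_topology}, 'e::euclidean_space) chart set \<Rightarrow> bool"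
  where "smooth_atlas M \<longleftrightarrow>
    (\<Union>(U, \<phi>)\<in>M. U) = UNIV \<and>
    (\<forall>(U, \<phi>)\<in>M. open U \<and> open (\<phi> ` U) \<and> homeomorphism U (\<phi> ` U) \<phi> (inv_into U \<phi>)) \<and>
    (\<forall>(U, \<phi>)\<in>M. \<forall>(V, \<psi>)\<in>M. smooth_on (\<phi> ` (U \<inter> V)) (\<psi> \<circ> inv_into U \<phi>))"

definition prod_atlas ::
    "('m, 'e) chart set \<Rightarrow> ('n, 'd) chart set \<Rightarrow> ('m \<times> 'n, 'e \<times> 'd) chart set"
  where "prod_atlas M N = {(U \<times> V, map_prod \<phi> \<psi>) | U \<phi> V \<psi>. (U, \<phi>) \<in> M \<and> (V, \<psi>) \<in> N}"

definition smooth_map ::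
    "('m::topological_space, 'e::euclidean_space) chart set \<Rightarrow>
     ('n::topological_space, 'd::euclidean_space) chart set \<Rightarrow> ('m \<Rightarrow> 'n) \<Rightarrow> bool"
  where "smooth_map M N f \<longleftrightarrow> continuous_on UNIV f \<and>
    (\<forall>(U, \<phi>)\<in>M. \<forall>(V, \<psi>)\<in>N. smooth_on (\<phi> ` (U \<inter> f -` V)) (\<psi> \<circ> f \<circ> inv_into U \<phi>))"

definition smooth_functions ::
    "('m::topological_space, 'e::euclidean_space) chart set \<Rightarrow> ('m \<Rightarrow> real) set"
  where "smooth_functions M = {f. \<forall>(U, \<phi>)\<in>M. smooth_on (\<phi> ` U) (f \<circ> inv_into U \<phi>)}"

definition lie_group ::
    "('g::{t2_space, second_countable_topology}, 'e::euclidean_space) chart set \<Rightarrow>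
     ('g \<Rightarrow> 'g \<Rightarrow> 'g) \<Rightarrow> 'g \<Rightarrow> ('g \<Rightarrow> 'g) \<Rightarrow> bool"
  where "lie_group M mul e iv \<longleftrightarrow>
    smooth_atlas M \<and> group mul e iv \<and>
    smooth_map (prod_atlas M M) M (\<lambda>(x, y). mul x y) \<and> smooth_map M M iv"


section \<open>Tangent vectors and vector fields\<close>

text \<open>Tangent vectors at \<open>p\<close> are the derivations at \<open>p\<close> of the algebra of smooth functions. They
  are set to \<open>0\<close> on non-smooth arguments, so that equality of tangent vectors is HOL equality.\<close>

type_synonym 'm tangent = "('m \<Rightarrow> real) \<Rightarrow> real"
type_synonym 'm vector_field = "'m \<Rightarrow> 'm tangent"
type_synonym 'm connection = "'m vector_field \<Rightarrow> 'm vector_field \<Rightarrow> 'm vector_field"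
type_synonym 'm metric = "'m \<Rightarrow> 'm tangent \<Rightarrow> 'm tangent \<Rightarrow> real"

definition tangent_space ::
    "('m::topological_space, 'e::euclidean_space) chart set \<Rightarrow> 'm \<Rightarrow> 'm tangent set"
  where "tangent_space M p = {v.
    (\<forall>f\<in>smooth_functions M. \<forall>h\<in>smooth_functions M. v (\<lambda>x. f x + h x) = v f + v h) \<and>
    (\<forall>f\<in>smooth_functions M. \<forall>c. v (\<lambda>x. c * f x) = c * v f) \<and>
    (\<forall>f\<in>smooth_functions M. \<forall>h\<in>smooth_functions M. v (\<lambda>x. f x * h x) = f p * v h + h p * v f) \<and>
    (\<forall>f. f \<notin> smooth_functions M \<longrightarrow> v f = 0)}"

text \<open>The action of a vector field on a function, giving a function.\<close>

definition deriv_along :: "'m vector_field \<Rightarrow> ('m \<Rightarrow> real) \<Rightarrow> 'm \<Rightarrow> real"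
  where "deriv_along X f = (\<lambda>p. X p f)"

definition vector_fields ::
    "('m::topological_space, 'e::euclidean_space) chart set \<Rightarrow> 'm vector_field set"
  where "vector_fields M = {X. (\<forall>p. X p \<in> tangent_space M p) \<and>
    (\<forall>f\<in>smooth_functions M. deriv_along X f \<in> smooth_functions M)}"

definition fun_scale :: "('m \<Rightarrow> real) \<Rightarrow> 'm vector_field \<Rightarrow> 'm vector_field"
  where "fun_scale f X = (\<lambda>p. f p *\<^sub>R X p)"

definition lie_bracket :: "'m vector_field \<Rightarrow> 'm vector_field \<Rightarrow> 'm vector_field"
  where "lie_bracket X Y = (\<lambda>p f. X p (deriv_along Y f) - Y p (deriv_along X f))"

definition smooth_frame ::
    "('m::topological_space, 'e::euclidean_space) chart set \<Rightarrow> ('n::finite \<Rightarrow> 'm vector_field) \<Rightarrow> bool"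
  where "smooth_frame M A \<longleftrightarrow> (\<forall>i. A i \<in> vector_fields M) \<and>
    (\<forall>p. inj (\<lambda>i. A i p) \<and> independent (range (\<lambda>i. A i p)) \<and>
         span (range (\<lambda>i. A i p)) = tangent_space M p)"

definition constant_wrt :: "('n::finite \<Rightarrow> 'm vector_field) \<Rightarrow> 'm vector_field \<Rightarrow> bool"
  where "constant_wrt A X \<longleftrightarrow> (\<exists>c. \<forall>p. X p = (\<Sum>i\<in>UNIV. c i *\<^sub>R A i p))"


section \<open>Metrics, connections and generalised Laplacians\<close>

definition riemannian_metric ::
    "('m::topological_space, 'e::euclidean_space) chart set \<Rightarrow> 'm metric \<Rightarrow> bool"
  where "riemannian_metric M G \<longleftrightarrow>
    (\<forall>p. \<forall>u\<in>tangent_space M p. \<forall>v\<in>tangent_space M p. \<forall>w\<in>tangent_space M p. \<forall>c.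
        G p (u + v) w = G p u w + G p v w \<and> G p (c *\<^sub>R u) w = c * G p u w \<and> G p u w = G p w u) \<and>
    (\<forall>p. \<forall>u\<in>tangent_space M p. u \<noteq> 0 \<longrightarrow> G p u u > 0) \<and>
    (\<forall>X\<in>vector_fields M. \<forall>Y\<in>vector_fields M. (\<lambda>p. G p (X p) (Y p)) \<in> smooth_functions M)"

definition affine_connection ::
    "('m::topological_space, 'e::euclidean_space) chart set \<Rightarrow> 'm connection \<Rightarrow> bool"
  where "affine_connection M D \<longleftrightarrow>
    (\<forall>X\<in>vector_fields M. \<forall>Y\<in>vector_fields M. D X Y \<in> vector_fields M) \<and>
    (\<forall>X\<in>vector_fields M. \<forall>X'\<in>vector_fields M. \<forall>Y\<in>vector_fields M. D (X + X') Y = D X Y + D X' Y) \<and>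
    (\<forall>X\<in>vector_fields M. \<forall>Y\<in>vector_fields M. \<forall>Y'\<in>vector_fields M. D X (Y + Y') = D X Y + D X Y') \<and>
    (\<forall>X\<in>vector_fields M. \<forall>Y\<in>vector_fields M. \<forall>f\<in>smooth_functions M.
        D (fun_scale f X) Y = fun_scale f (D X Y) \<and>
        D X (fun_scale f Y) = fun_scale (deriv_along X f) Y + fun_scale f (D X Y))"

definition levi_civita ::
    "('m::topological_space, 'e::euclidean_space) chart set \<Rightarrow> 'm metric \<Rightarrow> 'm connection \<Rightarrow> bool"
  where "levi_civita M G D \<longleftrightarrow> affine_connection M D \<and>
    (\<forall>X\<in>vector_fields M. \<forall>Y\<in>vector_fields M. D X Y - D Y X = lie_bracket X Y) \<and>
    (\<forall>X\<in>vector_fields M. \<forall>Y\<in>vector_fields M. \<forall>Z\<in>vector_fields M. \<forall>p.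
        deriv_along X (\<lambda>q. G q (Y q) (Z q)) p = G p (D X Y p) (Z p) + G p (Y p) (D X Z p))"

definition lie_cartan_connection ::
    "('m::topological_space, 'e::euclidean_space) chart set \<Rightarrow> ('n::finite \<Rightarrow> 'm vector_field) \<Rightarrow>
     real \<Rightarrow> 'm connection \<Rightarrow> bool"
  where "lie_cartan_connection M A \<nu> D \<longleftrightarrow> affine_connection M D \<and>
    (\<forall>X\<in>vector_fields M. \<forall>Y\<in>vector_fields M. constant_wrt A X \<longrightarrow> constant_wrt A Y \<longrightarrow>
        D X Y = \<nu> *\<^sub>R lie_bracket X Y)"

text \<open>Trace of an endomorphism \<open>L\<close> of a finite-dimensional subspace \<open>V\<close>.\<close>

definition trace_on :: "'v::real_vector set \<Rightarrow> ('v \<Rightarrow> 'v) \<Rightarrow> real"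
  where "trace_on V L =
    (let B = (SOME B. independent B \<and> span B = V) in \<Sum>b\<in>B. representation B (L b) b)"

text \<open>The endomorphism \<open>Z \<mapsto> \<nabla>\<^bsub>Z\<^esub> X\<close> of the tangent space at \<open>p\<close>: since \<open>D\<close> acts on vector
  fields, the tangent vector is first extended to a smooth vector field. By linearity of \<open>D\<close> over
  the smooth functions in its first argument, the result is independent of the extension.\<close>

definition covariant_differential ::
    "('m::topological_space, 'e::euclidean_space) chart set \<Rightarrow> 'm connection \<Rightarrow> 'm vector_field \<Rightarrow>
     'm \<Rightarrow> 'm tangent \<Rightarrow> 'm tangent"
  where "covariant_differential M D X p v = D (SOME Z. Z \<in> vector_fields M \<and> Z p = v) X p"

definition divergence ::
    "('m::topological_space, 'e::euclidean_space) chart set \<Rightarrow> 'm connection \<Rightarrow> 'm vector_field \<Rightarrow>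
     'm \<Rightarrow> real"
  where "divergence M D X p = trace_on (tangent_space M p) (covariant_differential M D X p)"

definition gradient ::
    "('m::topological_space, 'e::euclidean_space) chart set \<Rightarrow> 'm metric \<Rightarrow> ('m \<Rightarrow> real) \<Rightarrow> 'm vector_field"
  where "gradient M G f p =
    (THE v. v \<in> tangent_space M p \<and> (\<forall>w\<in>tangent_space M p. G p v w = w f))"

lemma smooth_frame_expand:
  assumes "smooth_frame M A" "v \<in> tangent_space M p"
  obtains c where "v = (\<Sum>i\<in>UNIV. c i *\<^sub>R A i p)"
proof -
  have inj: "inj (\<lambda>i. A i p)" and sp: "span (range (\<lambda>i. A i p)) = tangent_space M p"
    using assms(1) by (auto simp: smooth_frame_def)
  have "finite (range (\<lambda>i. A i p))" by simp
  then obtain u where "v = (\<Sum>x\<in>range (\<lambda>i. A i p). u x *\<^sub>R x)"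
    using assms(2) sp span_finite[of "range (\<lambda>i. A i p)"] by auto
  also have "\<dots> = (\<Sum>i\<in>UNIV. u (A i p) *\<^sub>R A i p)"
    by (simp add: sum.reindex[OF inj])
  finally show ?thesis by (rule that)
qed

lemma smooth_frame_in_tangent_space:
  assumes "smooth_frame M A"
  shows "(\<Sum>i\<in>UNIV. c i *\<^sub>R A i p) \<in> tangent_space M p"
proof -
  have "(\<Sum>i\<in>UNIV. c i *\<^sub>R A i p) \<in> span (range (\<lambda>i. A i p))"
    by (intro span_sum span_scale span_base) auto
  then show ?thesis using assms by (auto simp: smooth_frame_def)
qed

lemma smooth_frame_coeffs_zero:
  assumes "smooth_frame M A" "(\<Sum>i\<in>UNIV. c i *\<^sub>R A i p) = 0"
  shows "c i = 0"
proof -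
  have inj: "inj (\<lambda>i. A i p)" and ind: "independent (range (\<lambda>i. A i p))"
    using assms(1) by (auto simp: smooth_frame_def)
  have "(\<Sum>x\<in>range (\<lambda>i. A i p). c (the_inv (\<lambda>i. A i p) x) *\<^sub>R x) = 0"
    using assms(2) by (simp add: sum.reindex[OF inj] the_inv_f_f[OF inj])
  from independentD[OF ind _ subset_refl this, of "A i p"]
  have "c (the_inv (\<lambda>i. A i p) (A i p)) = 0" by simp
  then show ?thesis by (simp add: the_inv_f_f[OF inj, of i])
qed

lemma metric_frame_sum:
  fixes A :: "'n::finite \<Rightarrow> 'm::topological_space vector_field" and g :: "real ^ 'n ^ 'n"
  assumes "smooth_frame M A" "riemannian_metric M G"
    and g: "\<And>i j. G p (A i p) (A j p) = g $ i $ j"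
  shows "G p (\<Sum>i\<in>UNIV. a i *\<^sub>R A i p) (\<Sum>j\<in>UNIV. b j *\<^sub>R A j p) =
    (\<Sum>i\<in>UNIV. \<Sum>j\<in>UNIV. a i * b j * g $ i $ j)"
proof -
  let ?T = "tangent_space M p"
  have add: "G p (u + v) w = G p u w + G p v w" and sc: "G p (c *\<^sub>R u) w = c * G p u w"
    and sym: "G p u w = G p w u"
    if "u \<in> ?T" "v \<in> ?T" "w \<in> ?T" for u v w c
    using assms(2) that unfolding riemannian_metric_def by blast+
  have T: "subspace ?T"
    using assms(1) subspace_span[of "range (\<lambda>i. A i p)"] by (auto simp: smooth_frame_def)
  have A: "A i p \<in> ?T" for i
    using assms(1) by (auto simp: smooth_frame_def vector_fields_def)
  have 1: "(\<Sum>i\<in>S. a i *\<^sub>R A i p) \<in> ?T" for S and a :: "'n \<Rightarrow> real"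
    using A T by (intro subspace_sum subspace_scale) auto
  have z: "G p 0 w = 0" if "w \<in> ?T" for w
    using sc[OF that that that, of 0] by simp
  have L: "G p (\<Sum>i\<in>S. a i *\<^sub>R A i p) w = (\<Sum>i\<in>S. a i * G p (A i p) w)"
    if "w \<in> ?T" for S and a :: "'n \<Rightarrow> real" and w
    using finite[of S]
  proof induction
    case empty
    then show ?case by (simp only: sum.empty z[OF that])
  next
    case (insert x S)
    have "G p (a x *\<^sub>R A x p + (\<Sum>i\<in>S. a i *\<^sub>R A i p)) w =
      G p (a x *\<^sub>R A x p) w + G p (\<Sum>i\<in>S. a i *\<^sub>R A i p) w"
      by (rule add[OF subspace_scale[OF T A] 1 that])
    then show ?case
      by (simp only: sum.insert[OF insert.hyps] insert.IH sc[OF A A that])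
  qed
  have "G p (A i p) (\<Sum>j\<in>UNIV. b j *\<^sub>R A j p) = (\<Sum>j\<in>UNIV. b j * g $ i $ j)" for i
    using sym[OF A A 1, of i b UNIV] L[OF A, of b UNIV i] sym[OF A A A] g by simp
  then show ?thesis
    using L[OF 1, of a UNIV b UNIV] by (simp add: sum_distrib_left mult.assoc)
qed

text \<open>The gradient is given by the usual formula in a frame with respect to which the metric is
  constant.\<close>

lemma gradient_frame:
  fixes A :: "'n::finite \<Rightarrow> 'm::topological_space vector_field" and g :: "real ^ 'n ^ 'n"
  assumes fr: "smooth_frame M A" and me: "riemannian_metric M G"
    and g: "\<And>i j p. G p (A i p) (A j p) = g $ i $ j"
  shows "gradient M G f p =
    (\<Sum>j\<in>UNIV. (\<Sum>i\<in>UNIV. matrix_inv g $ i $ j * A i p f) *\<^sub>R A j p)"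
proof -
  let ?T = "tangent_space M p"
  let ?h = "matrix_inv g"
  let ?v = "\<Sum>j\<in>UNIV. (\<Sum>i\<in>UNIV. ?h $ i $ j * A i p f) *\<^sub>R A j p"
  note G = metric_frame_sum[OF fr me, of p g, OF g]
  have pos: "u \<in> ?T \<Longrightarrow> G p u u = 0 \<Longrightarrow> u = 0" for u
    using me unfolding riemannian_metric_def by (metis less_irrefl)
  have "x = 0" if x: "g *v x = 0" for x
  proof -
    have "(\<Sum>j\<in>UNIV. x $ i * x $ j * g $ i $ j) = x $ i * (g *v x) $ i" for i
      by (simp add: matrix_vector_mult_def sum_distrib_left mult_ac)
    then have "G p (\<Sum>i\<in>UNIV. x $ i *\<^sub>R A i p) (\<Sum>i\<in>UNIV. x $ i *\<^sub>R A i p) = 0"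
      using x by (simp add: G)
    then have "(\<Sum>i\<in>UNIV. x $ i *\<^sub>R A i p) = 0"
      by (intro pos smooth_frame_in_tangent_space[OF fr])
    then show ?thesis
      using smooth_frame_coeffs_zero[OF fr, of "\<lambda>i. x $ i"] by (simp add: vec_eq_iff)
  qed
  then have "invertible g"
    using invertible_left_inverse matrix_left_invertible_ker by blast
  then have hg: "?h ** g = mat 1"
    unfolding invertible_def matrix_inv_def by (metis (mono_tags, lifting) someI_ex)
  have vT: "?v \<in> ?T" by (rule smooth_frame_in_tangent_space[OF fr])
  have v: "G p ?v w = w f" if "w \<in> ?T" for w
  proof -
    obtain c where w: "w = (\<Sum>k\<in>UNIV. c k *\<^sub>R A k p)"
      using smooth_frame_expand[OF fr \<open>w \<in> ?T\<close>] by blast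
    have "G p ?v w = (\<Sum>j\<in>UNIV. \<Sum>k\<in>UNIV. (\<Sum>i\<in>UNIV. ?h $ i $ j * A i p f) * c k * g $ j $ k)"
      unfolding w by (rule G)
    also have "\<dots> = (\<Sum>j\<in>UNIV. \<Sum>k\<in>UNIV. \<Sum>i\<in>UNIV. A i p f * c k * (?h $ i $ j * g $ j $ k))"
      by (simp add: sum_distrib_right sum_distrib_left mult_ac)
    also have "\<dots> = (\<Sum>k\<in>UNIV. \<Sum>j\<in>UNIV. \<Sum>i\<in>UNIV. A i p f * c k * (?h $ i $ j * g $ j $ k))"
      by (rule sum.swap)
    also have "\<dots> = (\<Sum>k\<in>UNIV. \<Sum>i\<in>UNIV. \<Sum>j\<in>UNIV. A i p f * c k * (?h $ i $ j * g $ j $ k))"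
      by (intro sum.cong refl sum.swap)
    also have "\<dots> = (\<Sum>k\<in>UNIV. \<Sum>i\<in>UNIV. A i p f * c k * (?h ** g) $ i $ k)"
      by (simp add: matrix_matrix_mult_def sum_distrib_left)
    also have "\<dots> = (\<Sum>k\<in>UNIV. \<Sum>i\<in>UNIV. if i = k then A k p f * c k else 0)"
      unfolding hg by (intro sum.cong refl) (simp add: mat_def)
    also have "\<dots> = (\<Sum>k\<in>UNIV. c k * A k p f)"
      by (simp add: mult.commute)
    also have "\<dots> = w f"
    proof -
      have "(\<Sum>k\<in>S. c k *\<^sub>R A k p) f = (\<Sum>k\<in>S. c k * A k p f)" for S :: "'n set"
        using finite[of S] by induction (auto simp: scaleR_fun_apply)
      then show ?thesis by (simp add: w)
    qed
    finally show ?thesis .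
  qed
  show ?thesis
    unfolding gradient_def
  proof (rule the_equality)
    show "?v \<in> ?T \<and> (\<forall>w\<in>?T. G p ?v w = w f)" using vT v by blast
  next
    fix u assume u: "u \<in> ?T \<and> (\<forall>w\<in>?T. G p u w = w f)"
    have T: "subspace ?T"
      using fr subspace_span[of "range (\<lambda>i. A i p)"] by (auto simp: smooth_frame_def)
    have bil: "G p (a + b) w = G p a w + G p b w" "G p (c *\<^sub>R a) w = c * G p a w"
      if "a \<in> ?T" "b \<in> ?T" "w \<in> ?T" for a b w c
      using me that unfolding riemannian_metric_def by blast+
    have d: "u - ?v \<in> ?T" using u vT T by (simp add: subspace_diff)
    have m: "(-1) *\<^sub>R ?v \<in> ?T" using vT T by (simp only: subspace_scale)
    have "G p (u - ?v) (u - ?v) = G p (u + (-1) *\<^sub>R ?v) (u - ?v)" by simp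
    also have "\<dots> = G p u (u - ?v) + (-1) * G p ?v (u - ?v)"
      using bil(1)[OF _ m d, of u] bil(2)[OF vT vT d, of "-1"] u by simp
    also have "\<dots> = 0" using u v[OF d] d by simp
    finally show "u = ?v" using pos[OF d] by simp
  qed
qed

definition laplacian ::
    "('m::topological_space, 'e::euclidean_space) chart set \<Rightarrow> 'm metric \<Rightarrow> 'm connection \<Rightarrow>
     ('m \<Rightarrow> real) \<Rightarrow> 'm \<Rightarrow> real"
  where "laplacian M G D f = divergence M D (gradient M G f)"

end

theory Submission
  imports Defs
begin

text \<open>Write \<open>h\<^sub>j = g\<^sup>i\<^sup>j A\<^sub>i f\<close> for the components of the gradient of \<open>f\<close>, and let \<open>\<omega>\<close> be the
  coefficients of an affine connection in the frame, \<open>\<nabla>\<close> of \<open>A\<^sub>j\<close> along \<open>A\<^sub>i\<close> being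
  \<open>\<Sum>\<^sub>k \<omega> i j k A\<^sub>k\<close>. By the Leibniz rule the endomorphism \<open>Z \<mapsto> \<nabla>\<^bsub>Z\<^esub> (\<Sum>\<^sub>j h\<^sub>j A\<^sub>j)\<close> has in
  the frame the entries \<open>A\<^sub>i h\<^sub>k + \<Sum>\<^sub>j h\<^sub>j \<omega> i j k\<close>. Its trace is the Laplacian. As the \<open>g\<^sup>i\<^sup>j\<close> are
  constant, \<open>\<Sum>\<^sub>i A\<^sub>i h\<^sub>i\<close> is the second-order part \<open>g\<^sup>i\<^sup>j A\<^sub>i A\<^sub>j f\<close>, whatever the connection is; the
  connection enters only through the traces \<open>\<Sum>\<^sub>k \<omega> k i k\<close> of the first-order part
  (\<open>laplacian_frame\<close>).

  It remains to compute these traces. For the Lie-Cartan connection \<open>\<omega> = \<nu> d\<close>, since frame fields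
  are constant with respect to the frame (\<open>lie_cartan_frame\<close>). For the Levi-Civita connection
  \<open>\<omega> = \<Gamma>\<close>; compatibility with a metric whose components are constant says that \<open>\<Gamma> i k l\<close>, with its
  last index lowered, is skew in \<open>k, l\<close>, so \<open>\<Sum>\<^sub>k \<Gamma> i k k = 0\<close> (\<open>levi_civita_lower_trace\<close>), and since
  the torsion vanishes, \<open>d k i k = \<Gamma> k i k - \<Gamma> i k k\<close>, so the remaining trace of \<open>\<Gamma>\<close> equals that of
  \<open>d\<close> (\<open>levi_civita_trace\<close>).

  The difference of the two Laplacians at \<open>p\<close> is thus \<open>1 - \<nu>\<close> times one tangent vector, obtained by
  raising the index of the covector \<open>\<tau>\<^sub>i = \<Sum>\<^sub>k d k i k\<close>. A tangent vector that kills all smooth functions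
  is \<open>0\<close>, so if \<open>\<tau> \<noteq> 0\<close> somewhere then the operators agree only for \<open>\<nu> = 1\<close>
  (\<open>gradient_pairing_zero\<close>).

  Two points of rigour take most of the space. The gradient has to be a smooth vector field before a
  connection may be applied to it, so smooth functions have to form an algebra. And a connection acts
  on vector fields, so \<open>Z \<mapsto> \<nabla>\<^bsub>Z\<^esub> X\<close> makes sense for a tangent vector \<open>Z\<close> only if the choice of a
  field that extends it is irrelevant; this needs the components of every smooth field in the frame to
  be smooth functions (\<open>smooth_coefficients\<close>).\<close>


section \<open>The algebra of smooth functions\<close>

lemma Ck_on_const: "Ck_on k S (\<lambda>x. c)"
  by (induction k arbitrary: c) (auto simp: frechet_derivative_const)

text \<open>Congruence on an open set is what allows the product and sum rules, which hold only on the domain, to be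
  substituted under the recursion: \<open>frechet_derivative\<close> depends on values near a point only.\<close>

lemma Ck_on_cong:
  assumes "open S" "\<And>x. x \<in> S \<Longrightarrow> f x = h x" "Ck_on k S f"
  shows "Ck_on k S h"
  using assms(2,3)
proof (induction k arbitrary: f h)
  case 0
  then show ?case using continuous_on_cong[of S S f h] by simp
next
  case (Suc k)
  have D: "(h has_derivative frechet_derivative f (at x)) (at x)" if "x \<in> S" for x
  proof (rule has_derivative_transform_within_open[OF _ assms(1) that])
    show "(f has_derivative frechet_derivative f (at x)) (at x)"
      using Suc.prems(2) that assms(1)
      by (auto simp: differentiable_on_eq_differentiable_at frechet_derivative_works[symmetric])
  qed (use Suc.prems in auto)
  have "h differentiable_on S"
    using D assms(1) by (auto simp: differentiable_on_eq_differentiable_at differentiable_def)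
  moreover have "Ck_on k S (\<lambda>x. frechet_derivative h (at x) v)" for v
  proof (rule Suc.IH)
    show "Ck_on k S (\<lambda>x. frechet_derivative f (at x) v)" using Suc.prems by simp
  qed (use frechet_derivative_at[OF D] in auto)
  ultimately show ?case by simp
qed

lemma Ck_on_Suc_imp_Ck_on: "Ck_on (Suc k) S f \<Longrightarrow> Ck_on k S f"
proof (induction k arbitrary: f)
  case 0
  then show ?case by (simp add: differentiable_imp_continuous_on)
next
  case (Suc k)
  then show ?case by (metis Ck_on.simps(2))
qed

lemma Ck_on_add:
  assumes "open S" "Ck_on k S f" "Ck_on k S h"
  shows "Ck_on k S (\<lambda>x. f x + h x)"
  using assms(2,3)
proof (induction k arbitrary: f h)
  case 0
  then show ?case by (simp add: continuous_on_add)
next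
  case (Suc k)
  have d: "f differentiable at x" "h differentiable at x" if "x \<in> S" for x
    using Suc.prems that assms(1) by (auto simp: differentiable_on_eq_differentiable_at)
  have "Ck_on k S (\<lambda>x. frechet_derivative (\<lambda>x. f x + h x) (at x) v)" for v
  proof (rule Ck_on_cong[OF assms(1)])
    show "Ck_on k S (\<lambda>x. frechet_derivative f (at x) v + frechet_derivative h (at x) v)"
      using Suc by simp
    show "frechet_derivative f (at x) v + frechet_derivative h (at x) v =
        frechet_derivative (\<lambda>x. f x + h x) (at x) v" if "x \<in> S" for x
      using frechet_derivative_at[OF has_derivative_add[of f "frechet_derivative f (at x)" "at x" h]]
        d[OF that] by (auto simp: frechet_derivative_works dest: fun_cong)
  qed
  then show ?case using Suc.prems by (simp add: differentiable_on_add)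
qed

text \<open>The derivative of a product contains the undifferentiated factors, so the induction needs that a
  \<open>C\<^sup>k\<^sup>+\<^sup>1\<close> function is \<open>C\<^sup>k\<close>.\<close>

lemma Ck_on_mult:
  fixes f h :: "'a::real_normed_vector \<Rightarrow> real"
  assumes "open S" "Ck_on k S f" "Ck_on k S h"
  shows "Ck_on k S (\<lambda>x. f x * h x)"
  using assms(2,3)
proof (induction k arbitrary: f h)
  case 0
  then show ?case by (simp add: continuous_on_mult)
next
  case (Suc k)
  have d: "f differentiable at x" "h differentiable at x" if "x \<in> S" for x
    using Suc.prems that assms(1) by (auto simp: differentiable_on_eq_differentiable_at)
  have "Ck_on k S (\<lambda>x. frechet_derivative (\<lambda>x. f x * h x) (at x) v)" for v
  proof (rule Ck_on_cong[OF assms(1)])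
    show "Ck_on k S (\<lambda>x. f x * frechet_derivative h (at x) v + frechet_derivative f (at x) v * h x)"
      using Suc.prems Ck_on_Suc_imp_Ck_on[OF Suc.prems(1)] Ck_on_Suc_imp_Ck_on[OF Suc.prems(2)]
      by (intro Ck_on_add[OF assms(1)] Suc.IH) simp_all
    show "f x * frechet_derivative h (at x) v + frechet_derivative f (at x) v * h x =
        frechet_derivative (\<lambda>x. f x * h x) (at x) v" if "x \<in> S" for x
      using frechet_derivative_at[OF has_derivative_mult[of f "frechet_derivative f (at x)" x UNIV h]]
        d[OF that] by (auto simp: frechet_derivative_works dest: fun_cong)
  qed
  then show ?case using Suc.prems by (simp add: differentiable_on_mult)
qed

lemma smooth_functions_const: "(\<lambda>x. c) \<in> smooth_functions M"
  by (auto simp: smooth_functions_def smooth_on_def comp_def Ck_on_const)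

lemma smooth_functions_add:
  assumes "smooth_atlas M" "f \<in> smooth_functions M" "h \<in> smooth_functions M"
  shows "(\<lambda>x. f x + h x) \<in> smooth_functions M"
  using assms unfolding smooth_functions_def smooth_on_def smooth_atlas_def comp_def
  by (auto intro!: Ck_on_add)

lemma smooth_functions_mult:
  assumes "smooth_atlas M" "f \<in> smooth_functions M" "h \<in> smooth_functions M"
  shows "(\<lambda>x. f x * h x) \<in> smooth_functions M"
  using assms unfolding smooth_functions_def smooth_on_def smooth_atlas_def comp_def
  by (auto intro!: Ck_on_mult)

lemma smooth_functions_sum:
  assumes "smooth_atlas M" "\<And>i. i \<in> I \<Longrightarrow> F i \<in> smooth_functions M"
  shows "(\<lambda>x. \<Sum>i\<in>I. F i x) \<in> smooth_functions M"
  using assms(2)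
  by (induction I rule: infinite_finite_induct)
    (auto simp: smooth_functions_const intro: smooth_functions_add[OF assms(1)])


section \<open>Tangent vectors and vector fields\<close>

lemma sum_fun_apply: "(\<Sum>i\<in>I. F i) x = (\<Sum>i\<in>I. F i x)"
  by (induction I rule: infinite_finite_induct) auto

lemma tangent_vector_add:
  assumes "v \<in> tangent_space M p" "f \<in> smooth_functions M" "h \<in> smooth_functions M"
  shows "v (\<lambda>x. f x + h x) = v f + v h"
  using assms by (simp add: tangent_space_def)

lemma tangent_vector_scale:
  assumes "v \<in> tangent_space M p" "f \<in> smooth_functions M"
  shows "v (\<lambda>x. c * f x) = c * v f"
  using assms by (simp add: tangent_space_def)

text \<open>The derivation property applied to \<open>1 = 1 * 1\<close> gives \<open>v 1 = 2 * v 1\<close>.\<close>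

lemma tangent_vector_const:
  assumes "v \<in> tangent_space M p"
  shows "v (\<lambda>x. c) = 0"
proof -
  have prod: "v (\<lambda>x. f x * h x) = f p * v h + h p * v f"
    if "f \<in> smooth_functions M" "h \<in> smooth_functions M" for f h
    using assms that by (simp add: tangent_space_def)
  have "v (\<lambda>x. 1) = 0"
    using prod[OF smooth_functions_const smooth_functions_const, of 1 1] by simp
  then show ?thesis
    using tangent_vector_scale[OF assms smooth_functions_const, of c 1] by simp
qed

lemma tangent_vector_linear_sum:
  assumes "smooth_atlas M" "v \<in> tangent_space M p" "\<And>i. i \<in> I \<Longrightarrow> F i \<in> smooth_functions M"
  shows "v (\<lambda>x. \<Sum>i\<in>I. c i * F i x) = (\<Sum>i\<in>I. c i * v (F i))"
  using assms(3)
proof (induction I rule: infinite_finite_induct)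
  case (insert i I)
  have s: "(\<lambda>x. c j * F j x) \<in> smooth_functions M" if "j \<in> insert i I" for j
    using insert.prems that by (intro smooth_functions_mult[OF assms(1)] smooth_functions_const) auto
  have t: "(\<lambda>x. \<Sum>i\<in>I. c i * F i x) \<in> smooth_functions M"
    using s by (intro smooth_functions_sum[OF assms(1)]) auto
  show ?case
    using insert tangent_vector_add[OF assms(2) s t] tangent_vector_scale[OF assms(2)] by simp
qed (simp_all add: tangent_vector_const[OF assms(2)])

lemma tangent_space_add:
  assumes "u \<in> tangent_space M p" "v \<in> tangent_space M p"
  shows "u + v \<in> tangent_space M p"
  using assms unfolding tangent_space_def by (simp add: algebra_simps)

lemma tangent_space_scale:
  assumes "v \<in> tangent_space M p"
  shows "c *\<^sub>R v \<in> tangent_space M p"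
  using assms unfolding tangent_space_def by (simp add: scaleR_fun_apply algebra_simps)

lemma vector_fields_add:
  assumes "smooth_atlas M" "X \<in> vector_fields M" "Y \<in> vector_fields M"
  shows "X + Y \<in> vector_fields M"
  using assms unfolding vector_fields_def
  by (auto simp: deriv_along_def intro: tangent_space_add smooth_functions_add)

lemma vector_fields_fun_scale:
  assumes "smooth_atlas M" "h \<in> smooth_functions M" "X \<in> vector_fields M"
  shows "fun_scale h X \<in> vector_fields M"
  using assms unfolding vector_fields_def
  by (auto simp: deriv_along_def fun_scale_def scaleR_fun_apply
      intro: tangent_space_scale smooth_functions_mult)

lemma vector_fields_zero: "0 \<in> vector_fields M"
  unfolding vector_fields_def tangent_space_def
  by (auto simp: deriv_along_def smooth_functions_const)

lemma vector_fields_combination: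
  assumes "smooth_atlas M" "\<And>i. i \<in> I \<Longrightarrow> h i \<in> smooth_functions M"
    "\<And>i. i \<in> I \<Longrightarrow> X i \<in> vector_fields M"
  shows "(\<Sum>i\<in>I. fun_scale (h i) (X i)) \<in> vector_fields M"
  using assms(2,3)
  by (induction I rule: infinite_finite_induct)
    (auto intro: vector_fields_zero vector_fields_add[OF assms(1)]
      vector_fields_fun_scale[OF assms(1)])

lemma fun_scale_apply: "fun_scale h X p = h p *\<^sub>R X p"
  by (simp add: fun_scale_def)


section \<open>Affine connections on combinations of vector fields\<close>

lemma affine_connection_zero_left:
  assumes "affine_connection M D" "Y \<in> vector_fields M"
  shows "D 0 Y = 0"
proof -
  have "D (0 + 0) Y = D 0 Y + D 0 Y"
    using assms vector_fields_zero unfolding affine_connection_def by blast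
  then show ?thesis by simp
qed

lemma affine_connection_zero_right:
  assumes "affine_connection M D" "X \<in> vector_fields M"
  shows "D X 0 = 0"
proof -
  have "D X (0 + 0) = D X 0 + D X 0"
    using assms vector_fields_zero unfolding affine_connection_def by blast
  then show ?thesis by simp
qed

lemma affine_connection_combination_left:
  assumes at: "smooth_atlas M" and D: "affine_connection M D" and Y: "Y \<in> vector_fields M"
    and "\<And>i. i \<in> I \<Longrightarrow> h i \<in> smooth_functions M" "\<And>i. i \<in> I \<Longrightarrow> X i \<in> vector_fields M"
  shows "D (\<Sum>i\<in>I. fun_scale (h i) (X i)) Y = (\<Sum>i\<in>I. fun_scale (h i) (D (X i) Y))"
  using assms(4,5)
proof (induction I rule: infinite_finite_induct)
  case (insert i I)
  have "fun_scale (h i) (X i) \<in> vector_fields M"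
    "(\<Sum>i\<in>I. fun_scale (h i) (X i)) \<in> vector_fields M"
    using insert.prems
    by (auto intro: vector_fields_fun_scale[OF at] vector_fields_combination[OF at])
  then have "D (fun_scale (h i) (X i) + (\<Sum>i\<in>I. fun_scale (h i) (X i))) Y =
      D (fun_scale (h i) (X i)) Y + D (\<Sum>i\<in>I. fun_scale (h i) (X i)) Y"
    using D Y unfolding affine_connection_def by blast
  moreover have "D (fun_scale (h i) (X i)) Y = fun_scale (h i) (D (X i) Y)"
    using D Y insert.prems[of i] unfolding affine_connection_def by blast
  moreover have "D (\<Sum>i\<in>I. fun_scale (h i) (X i)) Y = (\<Sum>i\<in>I. fun_scale (h i) (D (X i) Y))"
    using insert.IH insert.prems by blast
  ultimately show ?case by (simp only: sum.insert[OF insert.hyps])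
qed (simp_all add: affine_connection_zero_left[OF D Y])

lemma affine_connection_combination_right:
  assumes at: "smooth_atlas M" and D: "affine_connection M D" and X: "X \<in> vector_fields M"
    and "\<And>i. i \<in> I \<Longrightarrow> h i \<in> smooth_functions M" "\<And>i. i \<in> I \<Longrightarrow> Y i \<in> vector_fields M"
  shows "D X (\<Sum>i\<in>I. fun_scale (h i) (Y i)) =
    (\<Sum>i\<in>I. fun_scale (deriv_along X (h i)) (Y i) + fun_scale (h i) (D X (Y i)))"
  using assms(4,5)
proof (induction I rule: infinite_finite_induct)
  case (insert i I)
  have "fun_scale (h i) (Y i) \<in> vector_fields M"
    "(\<Sum>i\<in>I. fun_scale (h i) (Y i)) \<in> vector_fields M"
    using insert.prems
    by (auto intro: vector_fields_fun_scale[OF at] vector_fields_combination[OF at])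
  then have "D X (fun_scale (h i) (Y i) + (\<Sum>i\<in>I. fun_scale (h i) (Y i))) =
      D X (fun_scale (h i) (Y i)) + D X (\<Sum>i\<in>I. fun_scale (h i) (Y i))"
    using D X unfolding affine_connection_def by blast
  moreover have "D X (fun_scale (h i) (Y i)) =
      fun_scale (deriv_along X (h i)) (Y i) + fun_scale (h i) (D X (Y i))"
    using D X insert.prems[of i] unfolding affine_connection_def by blast
  moreover have "D X (\<Sum>i\<in>I. fun_scale (h i) (Y i)) =
      (\<Sum>i\<in>I. fun_scale (deriv_along X (h i)) (Y i) + fun_scale (h i) (D X (Y i)))"
    using insert.IH insert.prems by blast
  ultimately show ?case by (simp only: sum.insert[OF insert.hyps])
qed (simp_all add: affine_connection_zero_right[OF D X])


section \<open>The trace in a basis indexed by a finite type\<close>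

text \<open>Uniqueness of coordinates, phrased for an indexed family so that identities between coordinate
  expressions can be read off index by index.\<close>

lemma independent_family_coeffs_unique:
  fixes E :: "'n::finite \<Rightarrow> 'v::real_vector"
  assumes "inj E" "independent (range E)"
    and eq: "(\<Sum>i\<in>UNIV. c i *\<^sub>R E i) = (\<Sum>i\<in>UNIV. c' i *\<^sub>R E i)"
  shows "c i = c' i"
proof -
  have "(\<Sum>x\<in>range E. (c (the_inv E x) - c' (the_inv E x)) *\<^sub>R x) =
      (\<Sum>i\<in>UNIV. (c i - c' i) *\<^sub>R E i)"
    by (simp add: sum.reindex[OF assms(1)] the_inv_f_f[OF assms(1)])
  also have "\<dots> = 0"
    using eq by (simp add: scaleR_diff_left sum_subtractf)
  finally have "(\<Sum>x\<in>range E. (c (the_inv E x) - c' (the_inv E x)) *\<^sub>R x) = 0" .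
  from independentD[OF assms(2) _ subset_refl this, of "E i"]
  show ?thesis by (simp add: the_inv_f_f[OF assms(1)])
qed

text \<open>The trace is defined through an unspecified basis \<open>B\<close>. If \<open>P\<close> expresses \<open>B\<close> in \<open>E\<close>
  and \<open>Q\<close> expresses \<open>E\<close> in \<open>B\<close>, the sum over \<open>B\<close> is \<open>tr (P a Q) = tr (a Q P)\<close>, and \<open>Q P = 1\<close>.\<close>

lemma trace_on_frame:
  fixes E :: "'n::finite \<Rightarrow> 'v::real_vector"
  assumes E: "inj E" "independent (range E)" "span (range E) = V"
    and L: "\<And>c. L (\<Sum>i\<in>UNIV. c i *\<^sub>R E i) = (\<Sum>i\<in>UNIV. c i *\<^sub>R (\<Sum>j\<in>UNIV. a i j *\<^sub>R E j))"
  shows "trace_on V L = (\<Sum>i\<in>UNIV. a i i)"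
proof -
  define B where "B = (SOME B. independent B \<and> span B = V)"
  have "independent B \<and> span B = V"
    unfolding B_def by (rule someI[where x = "range E"]) (use E in simp)
  then have B: "independent B" "span B = V" by auto
  have BE: "b \<in> span (range E)" if "b \<in> B" for b
    using that B E(3) span_base[of b B] by simp
  have fin: "finite B"
    using independent_span_bound[of "range E" B] B BE by auto
  have EB: "E i \<in> span B" for i
    using B E(3) span_base[of "E i" "range E"] by simp
  have "\<exists>c. b = (\<Sum>i\<in>UNIV. c i *\<^sub>R E i)" if b: "b \<in> B" for b
  proof -
    have "finite (range E)" by simp
    then obtain u where "b = (\<Sum>x\<in>range E. u x *\<^sub>R x)"
      using BE[OF b] span_finite[of "range E"] by auto
    then show ?thesis by (auto simp: sum.reindex[OF E(1)])
  qed
  then obtain P where P: "\<And>b. b \<in> B \<Longrightarrow> b = (\<Sum>i\<in>UNIV. P b i *\<^sub>R E i)" by metis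
  let ?Q = "\<lambda>j b. representation B (E j) b"
  have PQ: "(\<Sum>b\<in>B. ?Q j b * P b i) = (if i = j then 1 else 0)" for i j
  proof -
    have "(\<Sum>i\<in>UNIV. (\<Sum>b\<in>B. ?Q j b * P b i) *\<^sub>R E i) =
        (\<Sum>i\<in>UNIV. \<Sum>b\<in>B. ?Q j b *\<^sub>R (P b i *\<^sub>R E i))"
      by (simp add: scaleR_sum_left)
    also have "\<dots> = (\<Sum>b\<in>B. \<Sum>i\<in>UNIV. ?Q j b *\<^sub>R (P b i *\<^sub>R E i))"
      by (rule sum.swap)
    also have "\<dots> = (\<Sum>b\<in>B. ?Q j b *\<^sub>R b)"
      using P by (intro sum.cong refl) (simp only: scaleR_sum_right[symmetric])
    also have "\<dots> = E j"
      by (rule sum_representation_eq[OF B(1) EB fin order_refl])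
    also have "\<dots> = (\<Sum>i\<in>UNIV. (if i = j then 1 else 0) *\<^sub>R E i)"
      by (simp add: if_distrib[of "\<lambda>c. c *\<^sub>R _"] cong: if_cong)
    finally show ?thesis by (rule independent_family_coeffs_unique[OF E(1,2)])
  qed
  have "representation B (L b) b = (\<Sum>i\<in>UNIV. \<Sum>j\<in>UNIV. P b i * (a i j * ?Q j b))"
    if b: "b \<in> B" for b
  proof -
    have "L b = (\<Sum>i\<in>UNIV. P b i *\<^sub>R (\<Sum>j\<in>UNIV. a i j *\<^sub>R E j))"
      using P[OF b] L[of "P b"] by simp
    then show ?thesis
      using B(1) EB
      by (simp add: representation_sum representation_scale span_sum span_scale sum_distrib_left)
  qed
  then have "trace_on V L = (\<Sum>b\<in>B. \<Sum>i\<in>UNIV. \<Sum>j\<in>UNIV. P b i * (a i j * ?Q j b))"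
    by (simp add: trace_on_def Let_def flip: B_def)
  also have "\<dots> = (\<Sum>i\<in>UNIV. \<Sum>b\<in>B. \<Sum>j\<in>UNIV. P b i * (a i j * ?Q j b))"
    by (rule sum.swap)
  also have "\<dots> = (\<Sum>i\<in>UNIV. \<Sum>j\<in>UNIV. \<Sum>b\<in>B. P b i * (a i j * ?Q j b))"
    by (intro sum.cong refl sum.swap)
  also have "\<dots> = (\<Sum>i\<in>UNIV. \<Sum>j\<in>UNIV. a i j * (\<Sum>b\<in>B. ?Q j b * P b i))"
    by (simp add: sum_distrib_left mult_ac)
  also have "\<dots> = (\<Sum>i\<in>UNIV. a i i)"
    by (simp add: PQ if_distrib[of "\<lambda>c. _ * c"] cong: if_cong)
  finally show ?thesis .
qed


section \<open>Frames with constant metric components\<close>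

lemma smooth_frame_in_vector_fields: "smooth_frame M A \<Longrightarrow> A i \<in> vector_fields M"
  by (simp add: smooth_frame_def)

lemma smooth_frame_deriv_smooth:
  "smooth_frame M A \<Longrightarrow> f \<in> smooth_functions M \<Longrightarrow> deriv_along (A i) f \<in> smooth_functions M"
  by (simp add: smooth_frame_def vector_fields_def)

lemma smooth_frame_coeffs_unique:
  assumes "smooth_frame M A" "(\<Sum>i\<in>UNIV. c i *\<^sub>R A i p) = (\<Sum>i\<in>UNIV. c' i *\<^sub>R A i p)"
  shows "c i = c' i"
  using independent_family_coeffs_unique[of "\<lambda>i. A i p" c c'] assms by (simp add: smooth_frame_def)

locale constant_metric_frame =
  fixes M :: "('m::{t2_space, second_countable_topology}, 'e::euclidean_space) chart set"
    and A :: "'n::finite \<Rightarrow> 'm vector_field"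
    and G :: "'m metric"
    and g :: "real ^ 'n ^ 'n"
  assumes atlas: "smooth_atlas M"
    and frame: "smooth_frame M A"
    and metric: "riemannian_metric M G"
    and const: "G p (A i p) (A j p) = g $ i $ j"
begin

abbreviation dual_metric :: "real ^ 'n ^ 'n" where "dual_metric \<equiv> matrix_inv g"

lemma metric_combinations:
  "G p (\<Sum>i\<in>UNIV. a i *\<^sub>R A i p) (\<Sum>j\<in>UNIV. b j *\<^sub>R A j p) =
    (\<Sum>i\<in>UNIV. \<Sum>j\<in>UNIV. a i * b j * g $ i $ j)"
  by (rule metric_frame_sum[OF frame metric]) (rule const)

lemma metric_matrix_sym: "g $ i $ j = g $ j $ i"
proof -
  have "A i p \<in> tangent_space M p" for i p
    using smooth_frame_in_vector_fields[OF frame] by (auto simp: vector_fields_def)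
  then have "G p (A i p) (A j p) = G p (A j p) (A i p)" for p
    using metric unfolding riemannian_metric_def by blast
  then show ?thesis by (simp add: const)
qed

text \<open>A vector \<open>x\<close> in the kernel of \<open>g\<close> gives a tangent vector of length \<open>0\<close>, which definiteness
  forces to vanish.\<close>

lemma metric_matrix_invertible: "invertible g"
proof -
  have "x = 0" if "g *v x = 0" for x
  proof -
    fix p
    let ?u = "\<Sum>i\<in>UNIV. x $ i *\<^sub>R A i p"
    have "G p ?u ?u = (\<Sum>i\<in>UNIV. x $ i * (g *v x) $ i)"
      by (simp add: metric_combinations matrix_vector_mult_def
          sum_distrib_left mult_ac)
    also have "\<dots> = 0" using that by simp
    finally have "\<not> G p ?u ?u > 0" by simp
    moreover have "?u \<in> tangent_space M p"
      by (rule smooth_frame_in_tangent_space[OF frame])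
    ultimately have "?u = 0"
      using metric unfolding riemannian_metric_def by blast
    then show ?thesis
      using smooth_frame_coeffs_zero[OF frame, of "\<lambda>i. x $ i" p] by (simp add: vec_eq_iff)
  qed
  then show ?thesis using invertible_left_inverse matrix_left_invertible_ker by blast
qed

lemma matrix_inv_metric: "g ** dual_metric = mat 1" "dual_metric ** g = mat 1"
  using metric_matrix_invertible unfolding invertible_def matrix_inv_def
  by (metis (mono_tags, lifting) someI_ex)+

lemma matrix_inv_metric_sym: "dual_metric $ i $ j = dual_metric $ j $ i"
proof -
  have t: "transpose g = g"
    by (simp add: transpose_def vec_eq_iff metric_matrix_sym)
  have "transpose dual_metric = transpose dual_metric ** (g ** dual_metric)"
    by (simp add: matrix_inv_metric)
  also have "\<dots> = transpose (g ** dual_metric) ** dual_metric"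
    by (simp add: matrix_mul_assoc matrix_transpose_mul t)
  also have "\<dots> = dual_metric"
    by (simp add: matrix_inv_metric transpose_mat)
  finally have "transpose dual_metric $ j $ i = dual_metric $ j $ i" by simp
  then show ?thesis by (simp add: transpose_def)
qed

lemma matrix_inv_metric_contract:
  "(\<Sum>j\<in>UNIV. g $ i $ j * dual_metric $ j $ k) = (if i = k then 1 else 0)"
  using arg_cong[OF matrix_inv_metric(1), of "\<lambda>a. a $ i $ k"]
  by (simp add: matrix_matrix_mult_def mat_def)

text \<open>Pairing a field with the frame fields gives smooth functions, and the components of the field arise
  from these by applying a constant matrix, the inverse of \<open>g\<close>.\<close>

lemma smooth_coefficients:
  assumes "Z \<in> vector_fields M"
  obtains z where "\<And>i. z i \<in> smooth_functions M" "Z = (\<Sum>i\<in>UNIV. fun_scale (z i) (A i))"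
proof -
  have "\<exists>c. Z p = (\<Sum>i\<in>UNIV. c i *\<^sub>R A i p)" for p
  proof -
    have "Z p \<in> tangent_space M p" using assms by (simp add: vector_fields_def)
    from smooth_frame_expand[OF frame this] show ?thesis by blast
  qed
  then obtain c where c: "\<And>p. Z p = (\<Sum>i\<in>UNIV. c p i *\<^sub>R A i p)" by metis
  have pair: "G p (Z p) (A j p) = (\<Sum>i\<in>UNIV. c p i * g $ i $ j)" for p j
  proof -
    have "A j p = (\<Sum>i\<in>UNIV. (if i = j then 1 else 0) *\<^sub>R A i p)"
      by (simp add: if_distrib[of "\<lambda>c. c *\<^sub>R _"] cong: if_cong)
    then have "G p (Z p) (A j p) =
        G p (\<Sum>i\<in>UNIV. c p i *\<^sub>R A i p) (\<Sum>i\<in>UNIV. (if i = j then 1 else 0) *\<^sub>R A i p)"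
      using c by simp
    also have "\<dots> = (\<Sum>i\<in>UNIV. \<Sum>k\<in>UNIV. c p i * (if k = j then 1 else 0) * g $ i $ k)"
      by (rule metric_combinations)
    also have "\<dots> = (\<Sum>i\<in>UNIV. \<Sum>k\<in>UNIV. if k = j then c p i * g $ i $ k else 0)"
      by (intro sum.cong refl) simp
    finally show ?thesis by simp
  qed
  have coeff: "(\<Sum>j\<in>UNIV. dual_metric $ j $ k * G p (Z p) (A j p)) = c p k" for p k
  proof -
    have "(\<Sum>j\<in>UNIV. dual_metric $ j $ k * G p (Z p) (A j p)) =
        (\<Sum>j\<in>UNIV. \<Sum>i\<in>UNIV. c p i * (g $ i $ j * dual_metric $ j $ k))"
      by (simp add: pair sum_distrib_left mult_ac)
    also have "\<dots> = (\<Sum>i\<in>UNIV. \<Sum>j\<in>UNIV. c p i * (g $ i $ j * dual_metric $ j $ k))"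
      by (rule sum.swap)
    also have "\<dots> = (\<Sum>i\<in>UNIV. c p i * (if i = k then 1 else 0))"
      by (simp add: matrix_inv_metric_contract flip: sum_distrib_left)
    also have "\<dots> = c p k"
      by (simp add: if_distrib[of "\<lambda>c. _ * c"] cong: if_cong)
    finally show ?thesis .
  qed
  have "(\<lambda>p. \<Sum>j\<in>UNIV. dual_metric $ j $ k * G p (Z p) (A j p)) \<in> smooth_functions M" for k
    using metric assms smooth_frame_in_vector_fields[OF frame]
    by (intro smooth_functions_sum[OF atlas] smooth_functions_mult[OF atlas]
        smooth_functions_const) (auto simp: riemannian_metric_def)
  then have "(\<lambda>p. c p k) \<in> smooth_functions M" for k
    by (simp only: coeff)
  moreover have "Z = (\<Sum>i\<in>UNIV. fun_scale (\<lambda>p. c p i) (A i))"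
    by (rule ext) (simp only: c sum_fun_apply fun_scale_apply)
  ultimately show ?thesis by (rule that)
qed

text \<open>The extension \<open>Z\<close> of a tangent vector is an unspecified one. Expanding \<open>Z\<close> in the frame with smooth
  coefficients and using linearity of \<open>D\<close> over smooth functions shows that only the values of
  these coefficients at \<open>p\<close> matter, and these are determined by the tangent vector.\<close>

lemma covariant_differential_frame:
  assumes D: "affine_connection M D" and X: "X \<in> vector_fields M"
  shows "covariant_differential M D X p (\<Sum>i\<in>UNIV. c i *\<^sub>R A i p) = (\<Sum>i\<in>UNIV. c i *\<^sub>R D (A i) X p)"
proof -
  let ?v = "\<Sum>i\<in>UNIV. c i *\<^sub>R A i p"
  define Z where "Z = (SOME Z. Z \<in> vector_fields M \<and> Z p = ?v)"
  have "(\<Sum>i\<in>UNIV. fun_scale (\<lambda>_. c i) (A i)) \<in> vector_fields M"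
    using smooth_frame_in_vector_fields[OF frame]
    by (intro vector_fields_combination[OF atlas] smooth_functions_const)
  then have "(SOME Z. Z \<in> vector_fields M \<and> Z p = ?v) \<in> vector_fields M \<and>
      (SOME Z. Z \<in> vector_fields M \<and> Z p = ?v) p = ?v"
    by - (rule someI[where x = "\<Sum>i\<in>UNIV. fun_scale (\<lambda>_. c i) (A i)"],
      simp only: sum_fun_apply[of _ _ p] fun_scale_apply simp_thms)
  then have Z: "Z \<in> vector_fields M" "Z p = ?v" by (simp_all only: Z_def simp_thms)
  from smooth_coefficients[OF Z(1)] obtain z where
    z: "\<And>i. z i \<in> smooth_functions M" "Z = (\<Sum>i\<in>UNIV. fun_scale (z i) (A i))" by blast
  have "(\<Sum>i\<in>UNIV. z i p *\<^sub>R A i p) = ?v"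
    using Z(2) by (simp only: z(2) sum_fun_apply[of _ _ p] fun_scale_apply)
  then have zc: "z i p = c i" for i
    by (rule smooth_frame_coeffs_unique[OF frame, where c = "\<lambda>i. z i p"])
  have "D Z X p = (\<Sum>i\<in>UNIV. fun_scale (z i) (D (A i) X)) p"
    unfolding z(2)
    by (rule fun_cong[OF affine_connection_combination_left[OF atlas D X]])
      (rule z(1) smooth_frame_in_vector_fields[OF frame])+
  also have "\<dots> = (\<Sum>i\<in>UNIV. c i *\<^sub>R D (A i) X p)"
    by (simp only: sum_fun_apply[of _ _ p] fun_scale_apply zc)
  finally show ?thesis by (simp only: covariant_differential_def Z_def)
qed

lemma divergence_frame:
  assumes D: "affine_connection M D"
    and \<omega>: "\<And>i j. D (A i) (A j) p = (\<Sum>k\<in>UNIV. \<omega> i j k *\<^sub>R A k p)"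
    and h: "\<And>j. h j \<in> smooth_functions M"
  shows "divergence M D (\<Sum>j\<in>UNIV. fun_scale (h j) (A j)) p =
    (\<Sum>i\<in>UNIV. A i p (h i) + (\<Sum>j\<in>UNIV. h j p * \<omega> i j i))"
proof -
  let ?X = "\<Sum>j\<in>UNIV. fun_scale (h j) (A j)"
  note A = smooth_frame_in_vector_fields[OF frame]
  have X: "?X \<in> vector_fields M"
    using h A by (intro vector_fields_combination[OF atlas])
  have DX: "D (A i) ?X p = (\<Sum>k\<in>UNIV. (A i p (h k) + (\<Sum>j\<in>UNIV. h j p * \<omega> i j k)) *\<^sub>R A k p)" for i
  proof -
    have "D (A i) ?X p = (\<Sum>j\<in>UNIV. fun_scale (deriv_along (A i) (h j)) (A j)
        + fun_scale (h j) (D (A i) (A j))) p"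
      by (rule fun_cong[OF affine_connection_combination_right[OF atlas D A]]) (rule h A)+
    also have "\<dots> = (\<Sum>j\<in>UNIV. A i p (h j) *\<^sub>R A j p + h j p *\<^sub>R (\<Sum>k\<in>UNIV. \<omega> i j k *\<^sub>R A k p))"
      by (simp only: sum_fun_apply[of _ _ p] plus_fun_apply[of _ _ p] fun_scale_apply \<omega>
          deriv_along_def)
    also have "\<dots> = (\<Sum>j\<in>UNIV. A i p (h j) *\<^sub>R A j p)
        + (\<Sum>j\<in>UNIV. \<Sum>k\<in>UNIV. (h j p * \<omega> i j k) *\<^sub>R A k p)"
      by (simp only: sum.distrib scaleR_sum_right scaleR_scaleR)
    also have "(\<Sum>j\<in>UNIV. \<Sum>k\<in>UNIV. (h j p * \<omega> i j k) *\<^sub>R A k p)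
        = (\<Sum>k\<in>UNIV. (\<Sum>j\<in>UNIV. h j p * \<omega> i j k) *\<^sub>R A k p)"
      by (subst sum.swap) (simp only: scaleR_sum_left)
    finally show ?thesis
      by (simp only: scaleR_add_left sum.distrib)
  qed
  have "inj (\<lambda>i. A i p)" "independent (range (\<lambda>i. A i p))"
    "span (range (\<lambda>i. A i p)) = tangent_space M p"
    using frame by (auto simp: smooth_frame_def)
  then show ?thesis
    unfolding divergence_def
    by (rule trace_on_frame) (simp only: covariant_differential_frame[OF D X] DX)
qed

lemma gradient_combination:
  "gradient M G f = (\<Sum>j\<in>UNIV. fun_scale (\<lambda>p. \<Sum>i\<in>UNIV. dual_metric $ i $ j * A i p f) (A j))"
proof
  fix p
  have "gradient M G f p = (\<Sum>j\<in>UNIV. (\<Sum>i\<in>UNIV. dual_metric $ i $ j * A i p f) *\<^sub>R A j p)"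
    by (rule gradient_frame[OF frame metric]) (rule const)
  then show "gradient M G f p =
      (\<Sum>j\<in>UNIV. fun_scale (\<lambda>p. \<Sum>i\<in>UNIV. dual_metric $ i $ j * A i p f) (A j)) p"
    by (simp only: sum_fun_apply[of _ _ p] fun_scale_apply)
qed

text \<open>The first-order part is the only trace of the connection: the terms in which the components of the
  gradient are differentiated yield the second-order part, because the dual metric is constant and thus
  passes through the derivation \<open>A i p\<close>. Symmetry of the dual metric brings the indices into
  the stated positions.\<close>

lemma laplacian_frame:
  assumes D: "affine_connection M D"
    and \<omega>: "\<And>i j. D (A i) (A j) p = (\<Sum>k\<in>UNIV. \<omega> i j k *\<^sub>R A k p)"
    and f: "f \<in> smooth_functions M"
  shows "laplacian M G D f p =
    (\<Sum>i\<in>UNIV. \<Sum>j\<in>UNIV. dual_metric $ i $ j * deriv_along (A i) (deriv_along (A j) f) p) +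
    (\<Sum>i\<in>UNIV. \<Sum>j\<in>UNIV. \<Sum>k\<in>UNIV. \<omega> k i k * dual_metric $ i $ j * deriv_along (A j) f p)"
proof -
  let ?h = "\<lambda>j p. \<Sum>i\<in>UNIV. dual_metric $ i $ j * A i p f"
  have Af: "(\<lambda>p. A i p f) \<in> smooth_functions M" for i
    using smooth_frame_deriv_smooth[OF frame f, of i] by (simp add: deriv_along_def)
  have h: "?h j \<in> smooth_functions M" for j
    using Af by (intro smooth_functions_sum[OF atlas] smooth_functions_mult[OF atlas]
        smooth_functions_const)
  have "A i p \<in> tangent_space M p" for i
    using smooth_frame_in_vector_fields[OF frame] by (auto simp: vector_fields_def)
  then have Ah: "A i p (?h i) = (\<Sum>j\<in>UNIV. dual_metric $ i $ j * A i p (\<lambda>p. A j p f))" for i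
    using tangent_vector_linear_sum[OF atlas, of "A i p" p UNIV "\<lambda>j p. A j p f" "\<lambda>j. dual_metric $ j $ i"] Af
    by (simp add: matrix_inv_metric_sym[of i])
  have "(\<Sum>i\<in>UNIV. \<Sum>j\<in>UNIV. ?h j p * \<omega> i j i) =
      (\<Sum>j\<in>UNIV. \<Sum>i\<in>UNIV. \<Sum>l\<in>UNIV. \<omega> i j i * dual_metric $ j $ l * A l p f)"
    by (subst sum.swap) (simp add: sum_distrib_right sum_distrib_left mult_ac matrix_inv_metric_sym)
  also have "\<dots> = (\<Sum>j\<in>UNIV. \<Sum>l\<in>UNIV. \<Sum>i\<in>UNIV. \<omega> i j i * dual_metric $ j $ l * A l p f)"
    by (intro sum.cong refl sum.swap)
  finally show ?thesis
    unfolding laplacian_def gradient_combination divergence_frame[OF D \<omega> h] sum.distrib Ah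
    by (simp add: deriv_along_def)
qed

text \<open>Differentiating the constant \<open>G(A\<^sub>k, A\<^sub>l)\<close> along \<open>A\<^sub>i\<close> shows that \<open>\<Gamma> i k m g\<^sub>m\<^sub>l\<close> is skew in \<open>k, l\<close>.
  Its contraction with the symmetric \<open>g\<^sup>l\<^sup>k\<close> is the trace in question, and is therefore \<open>0\<close>.\<close>

lemma levi_civita_lower_trace:
  assumes LC: "levi_civita M G D"
    and \<Gamma>: "\<And>i j. D (A i) (A j) p = (\<Sum>k\<in>UNIV. \<Gamma> i j k *\<^sub>R A k p)"
  shows "(\<Sum>k\<in>UNIV. \<Gamma> i k k) = 0"
proof -
  note A = smooth_frame_in_vector_fields[OF frame]
  \<comment> \<open>Written this way, a single frame vector fits the formula for the metric on combinations.\<close>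
  have single: "A j p = (\<Sum>i\<in>UNIV. (if i = j then 1 else 0) *\<^sub>R A i p)" for j
    by (simp add: if_distrib[of "\<lambda>c. c *\<^sub>R _"] cong: if_cong)
  have lower: "G p (D (A i) (A k) p) (A l p) = (\<Sum>m\<in>UNIV. \<Gamma> i k m * g $ m $ l)" for k l
  proof -
    have "G p (D (A i) (A k) p) (A l p) =
        (\<Sum>m\<in>UNIV. \<Sum>n\<in>UNIV. \<Gamma> i k m * (if n = l then 1 else 0) * g $ m $ n)"
      unfolding \<Gamma> by (subst (2) single) (rule metric_combinations)
    also have "\<dots> = (\<Sum>m\<in>UNIV. \<Sum>n\<in>UNIV. if n = l then \<Gamma> i k m * g $ m $ n else 0)"
      by (intro sum.cong refl) simp
    finally show ?thesis by simp
  qed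
  have skew: "(\<Sum>m\<in>UNIV. \<Gamma> i k m * g $ m $ l) + (\<Sum>m\<in>UNIV. \<Gamma> i l m * g $ m $ k) = 0" for k l
  proof -
    have T: "A i p \<in> tangent_space M p" "D (A i) (A l) p \<in> tangent_space M p" "A k p \<in> tangent_space M p"
      using A LC by (auto simp: vector_fields_def levi_civita_def affine_connection_def)
    have "deriv_along (A i) (\<lambda>q. G q (A k q) (A l q)) p
        = G p (D (A i) (A k) p) (A l p) + G p (A k p) (D (A i) (A l) p)"
      using LC A unfolding levi_civita_def by blast
    moreover have "G p (A k p) (D (A i) (A l) p) = G p (D (A i) (A l) p) (A k p)"
      using metric T unfolding riemannian_metric_def by blast
    ultimately show ?thesis
      by (simp add: lower const deriv_along_def tangent_vector_const[OF T(1)])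
  qed
  \<comment> \<open>Raising the index that was lowered recovers the trace.\<close>
  have tr: "(\<Sum>k\<in>UNIV. \<Sum>l\<in>UNIV. (\<Sum>m\<in>UNIV. \<Gamma> i k m * g $ m $ l) * dual_metric $ l $ k) = (\<Sum>k\<in>UNIV. \<Gamma> i k k)"
  proof (rule sum.cong[OF refl])
    fix k
    have "(\<Sum>l\<in>UNIV. (\<Sum>m\<in>UNIV. \<Gamma> i k m * g $ m $ l) * dual_metric $ l $ k) =
        (\<Sum>m\<in>UNIV. \<Sum>l\<in>UNIV. \<Gamma> i k m * (g $ m $ l * dual_metric $ l $ k))"
      by (subst sum.swap) (simp add: sum_distrib_left mult_ac)
    also have "\<dots> = (\<Sum>m\<in>UNIV. \<Gamma> i k m * (if m = k then 1 else 0))"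
      by (simp add: matrix_inv_metric_contract flip: sum_distrib_left)
    finally show "(\<Sum>l\<in>UNIV. (\<Sum>m\<in>UNIV. \<Gamma> i k m * g $ m $ l) * dual_metric $ l $ k) = \<Gamma> i k k"
      by (simp add: if_distrib[of "\<lambda>c. _ * c"] cong: if_cong)
  qed
  have "0 = (\<Sum>k\<in>UNIV. \<Sum>l\<in>UNIV. ((\<Sum>m\<in>UNIV. \<Gamma> i k m * g $ m $ l)
      + (\<Sum>m\<in>UNIV. \<Gamma> i l m * g $ m $ k)) * dual_metric $ l $ k)"
    by (simp add: skew)
  also have "\<dots> = (\<Sum>k\<in>UNIV. \<Gamma> i k k)
      + (\<Sum>k\<in>UNIV. \<Sum>l\<in>UNIV. (\<Sum>m\<in>UNIV. \<Gamma> i l m * g $ m $ k) * dual_metric $ l $ k)"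
    by (simp only: distrib_right sum.distrib tr)
  also have "(\<Sum>k\<in>UNIV. \<Sum>l\<in>UNIV. (\<Sum>m\<in>UNIV. \<Gamma> i l m * g $ m $ k) * dual_metric $ l $ k) =
      (\<Sum>k\<in>UNIV. \<Gamma> i k k)"
    by (subst sum.swap, subst matrix_inv_metric_sym) (rule tr)
  finally show ?thesis by simp
qed

text \<open>Vanishing torsion means \<open>d k i l = \<Gamma> k i l - \<Gamma> i k l\<close>; put \<open>l = k\<close> and sum, the last term
  contributing nothing by the previous lemma.\<close>

lemma levi_civita_trace:
  assumes LC: "levi_civita M G D"
    and \<Gamma>: "\<And>i j. D (A i) (A j) p = (\<Sum>k\<in>UNIV. \<Gamma> i j k *\<^sub>R A k p)"
    and d: "\<And>i j. (\<Sum>k\<in>UNIV. d i j k *\<^sub>R A k p) = lie_bracket (A i) (A j) p"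
  shows "(\<Sum>k\<in>UNIV. \<Gamma> k i k) = (\<Sum>k\<in>UNIV. d k i k)"
proof -
  have "d k i l = \<Gamma> k i l - \<Gamma> i k l" for k l
  proof (rule smooth_frame_coeffs_unique[OF frame])
    have "D (A k) (A i) - D (A i) (A k) = lie_bracket (A k) (A i)"
      using LC smooth_frame_in_vector_fields[OF frame] unfolding levi_civita_def by blast
    then have "lie_bracket (A k) (A i) p = D (A k) (A i) p - D (A i) (A k) p"
      by (simp only: fun_diff_def flip: \<open>D (A k) (A i) - D (A i) (A k) = lie_bracket (A k) (A i)\<close>)
    then show "(\<Sum>l\<in>UNIV. d k i l *\<^sub>R A l p) = (\<Sum>l\<in>UNIV. (\<Gamma> k i l - \<Gamma> i k l) *\<^sub>R A l p)"
      by (simp only: d \<Gamma> scaleR_diff_left sum_subtractf)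
  qed
  then show ?thesis
    using levi_civita_lower_trace[OF LC \<Gamma>, of i] by (simp add: sum_subtractf)
qed

lemma lie_cartan_frame:
  assumes "lie_cartan_connection M A \<nu> D"
    and d: "\<And>i j. (\<Sum>k\<in>UNIV. d i j k *\<^sub>R A k p) = lie_bracket (A i) (A j) p"
  shows "D (A i) (A j) p = (\<Sum>k\<in>UNIV. (\<nu> * d i j k) *\<^sub>R A k p)"
proof -
  have "constant_wrt A (A i)" for i
    unfolding constant_wrt_def
    by (rule exI[of _ "\<lambda>j. if j = i then 1 else 0"])
      (simp add: if_distrib[of "\<lambda>c. c *\<^sub>R _"] cong: if_cong)
  then have "D (A i) (A j) = \<nu> *\<^sub>R lie_bracket (A i) (A j)"
    using assms(1) smooth_frame_in_vector_fields[OF frame] unfolding lie_cartan_connection_def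
    by blast
  then have "D (A i) (A j) p = \<nu> *\<^sub>R lie_bracket (A i) (A j) p"
    by (simp only: scaleR_fun_apply)
  then show ?thesis
    by (simp only: scaleR_sum_right scaleR_scaleR flip: d)
qed

text \<open>The tangent vector with components \<open>\<tau>\<^sub>i g\<^sup>i\<^sup>j\<close> vanishes on smooth functions by assumption and on all other
  functions by the convention for tangent vectors, so it is \<open>0\<close>. Linear independence of the
  frame and invertibility of the metric then give \<open>\<tau> = 0\<close>.\<close>

lemma gradient_pairing_zero:
  assumes "\<And>f. f \<in> smooth_functions M \<Longrightarrow>
    (\<Sum>i\<in>UNIV. \<Sum>j\<in>UNIV. \<tau> i * dual_metric $ i $ j * deriv_along (A j) f p) = 0"
  shows "\<tau> k = 0"
proof -
  let ?c = "\<lambda>j. \<Sum>i\<in>UNIV. \<tau> i * dual_metric $ i $ j"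
  let ?v = "\<Sum>j\<in>UNIV. ?c j *\<^sub>R A j p"
  have "?v f = 0" for f
  proof (cases "f \<in> smooth_functions M")
    case True
    have "?v f = (\<Sum>j\<in>UNIV. \<Sum>i\<in>UNIV. \<tau> i * dual_metric $ i $ j * A j p f)"
      by (simp only: sum_fun_apply[of _ _ f] scaleR_fun_apply real_scaleR_def sum_distrib_right)
    then show ?thesis
      using assms[OF True] by (subst (asm) sum.swap) (simp add: deriv_along_def)
  next
    case False
    then show ?thesis
      using smooth_frame_in_tangent_space[OF frame, of ?c p] unfolding tangent_space_def by blast
  qed
  then have "?v = 0" by (simp only: fun_eq_iff zero_fun_apply) simp
  then have c: "?c j = 0" for j
    by (rule smooth_frame_coeffs_zero[OF frame])
  have "0 = (\<Sum>j\<in>UNIV. ?c j * g $ j $ k)" by (simp add: c)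
  also have "\<dots> = (\<Sum>i\<in>UNIV. \<tau> i * (\<Sum>j\<in>UNIV. g $ k $ j * dual_metric $ j $ i))"
    unfolding sum_distrib_right
    by (subst sum.swap)
      (simp add: sum_distrib_left mult_ac matrix_inv_metric_sym metric_matrix_sym)
  also have "\<dots> = (\<Sum>i\<in>UNIV. \<tau> i * (if k = i then 1 else 0))"
    by (simp only: matrix_inv_metric_contract)
  finally show ?thesis by (simp add: if_distrib[of "\<lambda>c. _ * c"] cong: if_cong)
qed

end

theorem theorem2:
  fixes M :: "('g::{t2_space, second_countable_topology}, real ^ 'n) chart set"
    and mul :: "'g \<Rightarrow> 'g \<Rightarrow> 'g" and e :: 'g and iv :: "'g \<Rightarrow> 'g"
    and U :: "'g \<Rightarrow> 'd"
    and \<A> :: "('g \<Rightarrow> 'd) \<Rightarrow> 'n \<Rightarrow> 'g vector_field"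
    and G :: "'g metric"
    and g g_inv :: "real ^ 'n ^ 'n"
    and \<nu> :: real
    and D_\<nu> D_LC :: "'g connection"
    and d \<Gamma> :: "'n \<Rightarrow> 'n \<Rightarrow> 'n \<Rightarrow> 'g \<Rightarrow> real"
  assumes "lie_group M mul e iv"
    and "smooth_frame M (\<A> U)"
    and "riemannian_metric M G"
    and metric_constant: "\<And>i j p. G p (\<A> U i p) (\<A> U j p) = g $ i $ j"
    and g_inv: "g_inv = matrix_inv g"
    and "lie_cartan_connection M (\<A> U) \<nu> D_\<nu>"
    and "levi_civita M G D_LC"
    and structure_functions:
      "\<And>i j p. (\<Sum>k\<in>UNIV. d i j k p *\<^sub>R \<A> U k p) = lie_bracket (\<A> U i) (\<A> U j) p"
    and christoffel:
      "\<And>i j p. D_LC (\<A> U i) (\<A> U j) p = (\<Sum>k\<in>UNIV. \<Gamma> i j k p *\<^sub>R \<A> U k p)"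
  shows
    "(\<forall>f\<in>smooth_functions M. \<forall>p.
        laplacian M G D_\<nu> f p =
          (\<Sum>i\<in>UNIV. \<Sum>j\<in>UNIV. g_inv $ i $ j * deriv_along (\<A> U i) (deriv_along (\<A> U j) f) p) +
          \<nu> * (\<Sum>i\<in>UNIV. \<Sum>j\<in>UNIV. \<Sum>k\<in>UNIV. d k i k p * g_inv $ i $ j * deriv_along (\<A> U j) f p)) \<and>
     (\<forall>f\<in>smooth_functions M. \<forall>p.
        laplacian M G D_LC f p =
          (\<Sum>i\<in>UNIV. \<Sum>j\<in>UNIV. g_inv $ i $ j * deriv_along (\<A> U i) (deriv_along (\<A> U j) f) p) +
          (\<Sum>i\<in>UNIV. \<Sum>j\<in>UNIV. \<Sum>k\<in>UNIV. \<Gamma> k i k p * g_inv $ i $ j * deriv_along (\<A> U j) f p)) \<and>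
     (\<forall>f\<in>smooth_functions M. \<forall>p.
        laplacian M G D_LC f p =
          (\<Sum>i\<in>UNIV. \<Sum>j\<in>UNIV. g_inv $ i $ j * deriv_along (\<A> U i) (deriv_along (\<A> U j) f) p) +
          (\<Sum>i\<in>UNIV. \<Sum>j\<in>UNIV. \<Sum>k\<in>UNIV. d k i k p * g_inv $ i $ j * deriv_along (\<A> U j) f p)) \<and>
     (\<forall>f\<in>smooth_functions M. \<forall>p.
        laplacian M G D_LC f p - laplacian M G D_\<nu> f p =
          (1 - \<nu>) *
          (\<Sum>i\<in>UNIV. \<Sum>j\<in>UNIV. \<Sum>k\<in>UNIV. d k i k p * g_inv $ i $ j * deriv_along (\<A> U j) f p)) \<and>
     (\<nu> = 1 \<longrightarrow> (\<forall>f\<in>smooth_functions M. laplacian M G D_LC f = laplacian M G D_\<nu> f)) \<and>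
     ((\<exists>i p. (\<Sum>k\<in>UNIV. d k i k p) \<noteq> 0) \<longrightarrow>
        ((\<forall>f\<in>smooth_functions M. laplacian M G D_LC f = laplacian M G D_\<nu> f) \<longleftrightarrow> \<nu> = 1))"
proof -
  have "smooth_atlas M" using assms(1) by (simp add: lie_group_def)
  then interpret constant_metric_frame M "\<A> U" G g
    by (intro constant_metric_frame.intro assms(2,3) metric_constant)
  have LC: "affine_connection M D_LC" using assms(7) by (simp add: levi_civita_def)
  have \<nu>: "affine_connection M D_\<nu>" using assms(6) by (simp add: lie_cartan_connection_def)
  let ?L = "\<lambda>f p. \<Sum>i\<in>UNIV. \<Sum>j\<in>UNIV. g_inv $ i $ j * deriv_along (\<A> U i) (deriv_along (\<A> U j) f) p"
  let ?T = "\<lambda>f p. \<Sum>i\<in>UNIV. \<Sum>j\<in>UNIV. \<Sum>k\<in>UNIV. d k i k p * g_inv $ i $ j * deriv_along (\<A> U j) f p"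
  have lap_\<nu>: "laplacian M G D_\<nu> f p = ?L f p + \<nu> * ?T f p" if "f \<in> smooth_functions M" for f p
    using laplacian_frame[OF \<nu> lie_cartan_frame[OF assms(6) structure_functions] that, of p]
    by (simp add: g_inv sum_distrib_left mult.assoc)
  have lap_\<Gamma>: "laplacian M G D_LC f p = ?L f p +
      (\<Sum>i\<in>UNIV. \<Sum>j\<in>UNIV. \<Sum>k\<in>UNIV. \<Gamma> k i k p * g_inv $ i $ j * deriv_along (\<A> U j) f p)"
    if "f \<in> smooth_functions M" for f p
    using laplacian_frame[OF LC christoffel that, of p] by (simp add: g_inv)
  have "(\<Sum>k\<in>UNIV. \<Gamma> k i k p) = (\<Sum>k\<in>UNIV. d k i k p)" for i p
    by (rule levi_civita_trace[OF assms(7) christoffel structure_functions])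
  then have lap_d: "laplacian M G D_LC f p = ?L f p + ?T f p" if "f \<in> smooth_functions M" for f p
    using lap_\<Gamma>[OF that, of p] by (simp flip: sum_distrib_right)
  have diff: "laplacian M G D_LC f p - laplacian M G D_\<nu> f p = (1 - \<nu>) * ?T f p"
    if "f \<in> smooth_functions M" for f p
    by (simp only: lap_d[OF that] lap_\<nu>[OF that]) (simp add: left_diff_distrib)
  have "\<nu> = 1"
    if eq: "\<forall>f\<in>smooth_functions M. laplacian M G D_LC f = laplacian M G D_\<nu> f"
      and i: "(\<Sum>k\<in>UNIV. d k i k p) \<noteq> 0" for i p
  proof (rule ccontr)
    assume "\<nu> \<noteq> 1"
    then have "?T f p = 0" if "f \<in> smooth_functions M" for f
      using diff[OF that, of p] eq that by simp
    then have "(\<Sum>k\<in>UNIV. d k i k p) = 0"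
      by (intro gradient_pairing_zero[where \<tau> = "\<lambda>i. \<Sum>k\<in>UNIV. d k i k p"])
        (simp add: g_inv sum_distrib_right)
    with i show False by simp
  qed
  moreover have "laplacian M G D_LC f = laplacian M G D_\<nu> f"
    if "\<nu> = 1" "f \<in> smooth_functions M" for f
    using diff[OF that(2)] that(1) by (simp add: fun_eq_iff)
  ultimately show ?thesis
    using lap_\<nu> lap_\<Gamma> lap_d diff by blast
qed

end
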